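(* Let $n$ be a positive integer and let $D_n$ be a maximal Diophantine graph of order $n$ with Diophantine labelling $f$. Let $u,v$ be two vertices of $D_n$ with $\deg(u)<n-1$ and $\deg(v)<n-1$. If $\omega(f^*(u))=\omega(f^*(v))$ and for every prime number $p\mid f^*(u)$ there exists a prime number $q\mid f^*(v)$ such that $\left\lfloor\frac{n}{p^{\acute{v}_p(n)}}\right\rfloor=\left\lfloor\frac{n}{q^{\acute{v}_q(n)}}\right\rfloor$, then $\deg(u)=\deg(v)$.
   Context: All graphs are finite, simple and undirected, and $(a,b)$ denotes the greatest common divisor of $a$ and $b$. A graph $G=(V,E)$ of order $n$ is a Diophantine graph if there is a bijection $f:V\to\{1,2,\dots,n\}$ (a Diophantine labelling) such that $(f(u),f(v))\mid n$ for all $uv\in E$. It is a maximal Diophantine graph, denoted $(D_n,f)$ or simply $D_n$, if adding any new edge turns it into a non-Diophantine graph; thus two distinct vertices $u,v$ of $D_n$ are adjacent if and only if $(f(u),f(v))\mid n$. The reduced label of a vertex $u$ is $f^*(u):=\frac{f(u)}{(f(u),n)}$. For a prime $p$, $v_p(n)$ is the $p$-adic valuation of $n$, and $\acute{v}_p(n):=v_p(n)+1$. $\omega(m)$ is the number of distinct prime factors of the positive integer $m$. *)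

theory Defs
  imports
    Complex_Main
    "HOL-Computational_Algebra.Primes"
    "Graph_Theory.Graph_Theory"
begin

text \<open>
  A finite simple undirected graph is a \<open>pair_graph\<close>: a finite vertex set \<open>pverts\<close> with a
  symmetric, irreflexive arc relation \<open>parcs\<close>. An undirected edge \<open>uv\<close> is thus represented by
  the two arcs \<open>(u, v)\<close> and \<open>(v, u)\<close>.
\<close>

definition add_edge :: "'a pair_pre_digraph \<Rightarrow> 'a \<Rightarrow> 'a \<Rightarrow> 'a pair_pre_digraph" where
  "add_edge G u v = G\<lparr>parcs := parcs G \<union> {(u, v), (v, u)}\<rparr>"

text \<open>By symmetry each edge at \<open>u\<close> contributes exactly one arc leaving \<open>u\<close>.\<close>

definition vertex_degree :: "'a pair_pre_digraph \<Rightarrow> 'a \<Rightarrow> nat" where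
  "vertex_degree G u = out_degree (with_proj G) u"

definition diophantine_labelling :: "'a pair_pre_digraph \<Rightarrow> ('a \<Rightarrow> nat) \<Rightarrow> bool" where
  "diophantine_labelling G f \<longleftrightarrow>
     bij_betw f (pverts G) {1..card (pverts G)} \<and>
     (\<forall>(u, v) \<in> parcs G. gcd (f u) (f v) dvd card (pverts G))"

definition diophantine_graph :: "'a pair_pre_digraph \<Rightarrow> bool" where
  "diophantine_graph G \<longleftrightarrow> pair_graph G \<and> (\<exists>f. diophantine_labelling G f)"

definition maximal_diophantine_graph :: "'a pair_pre_digraph \<Rightarrow> bool" where
  "maximal_diophantine_graph G \<longleftrightarrow>
     diophantine_graph G \<and>
     (\<forall>u \<in> pverts G. \<forall>v \<in> pverts G.
        u \<noteq> v \<and> (u, v) \<notin> parcs G \<longrightarrow> \<not> diophantine_graph (add_edge G u v))"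

definition reduced_label :: "nat \<Rightarrow> ('a \<Rightarrow> nat) \<Rightarrow> 'a \<Rightarrow> nat" where
  "reduced_label n f u = f u div gcd (f u) n"

definition omega :: "nat \<Rightarrow> nat" where
  "omega m = card (prime_factors m)"

definition succ_valuation :: "nat \<Rightarrow> nat \<Rightarrow> nat" where
  "succ_valuation p n = multiplicity p n + 1"

end

theory Submission
  imports Defs
begin

text \<open>
  A prime \<open>p\<close> divides \<open>f\<^sup>*(u)\<close> iff \<open>p ^ (v\<^sub>p(n) + 1)\<close> divides \<open>f u\<close>; hence the vertices not
  adjacent to \<open>u\<close> are those whose label is a multiple of \<open>p ^ (v\<^sub>p(n) + 1)\<close> for some \<open>p\<close> in the
  set \<open>P\<close> of primes dividing \<open>f\<^sup>*(u)\<close>. Let \<open>Q\<close> be the corresponding set for \<open>v\<close>.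
  Any two of the prime powers belonging to \<open>P\<close> have product at most \<open>n\<close>, since they are coprime
  divisors of \<open>f u\<close>, and distinct \<open>a\<close>, \<open>b\<close> with \<open>a * b \<le> n\<close> have distinct quotients
  \<open>n div a\<close>, \<open>n div b\<close>. So the matching of \<open>P\<close> with \<open>Q\<close> is injective. If it moved two prime
  powers \<open>a\<close>, \<open>a'\<close> to \<open>b \<noteq> a\<close>, \<open>b' \<noteq> a'\<close>, then \<open>a * b > n\<close> and \<open>a' * b' > n\<close>, which contradicts
  \<open>a * a' \<le> n\<close> and \<open>b * b' \<le> n\<close>. Thus \<open>P\<close> and \<open>Q\<close> differ in at most one prime, and the
  contribution of that prime to the count depends only on its quotient.
\<close>

section \<open>Counting multiples\<close>

text \<open>If \<open>a < b\<close> and \<open>k = n div b\<close>, then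
  \<open>a * b \<le> n\<close> gives \<open>a \<le> k\<close>, so the \<open>k\<close> multiples of
  \<open>b\<close> leave room for one extra multiple of \<open>a\<close>:
  \<open>(k + 1) * a \<le> k * (a + 1) \<le> k * b \<le> n\<close>.\<close>

lemma div_eq_imp_eq:
  fixes a b n :: nat
  assumes "a > 0" "b > 0" "a * b \<le> n" "n div a = n div b"
  shows "a = b"
proof -
  have less: False if "a < b" "0 < a" "a * b \<le> n" "n div a = n div b" for a b :: nat
  proof -
    define k where "k = n div b"
    have "a \<le> k"
      using that by (simp add: k_def less_eq_div_iff_mult_less_eq)
    have "(k + 1) * a \<le> k * (a + 1)"
      using \<open>a \<le> k\<close> by simp
    also have "\<dots> \<le> k * b"
      using that(1) by (intro mult_le_mono) auto
    also have "\<dots> \<le> n"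
      by (simp add: k_def)
    finally have "k + 1 \<le> n div a"
      using that(2) by (simp add: less_eq_div_iff_mult_less_eq)
    then show False
      using that(4) by (simp add: k_def)
  qed
  show ?thesis
    using less[of a b] less[of b a] assms by (metis mult.commute nat_neq_iff)
qed

text \<open>The multiples of \<open>g p\<close> not yet counted are the \<open>g p * k\<close> with
  no \<open>g c\<close> dividing \<open>k\<close>, by coprimality. Their number depends on
  \<open>g p\<close> only through \<open>n div g p\<close>, so \<open>p\<close> can be exchanged for
  an element with the same quotient.\<close>

lemma card_multiples_insert:
  fixes g :: "'b \<Rightarrow> nat"
  assumes "g p > 0" "\<And>c. c \<in> C \<Longrightarrow> coprime (g c) (g p)"
  shows "card {x \<in> {1..n}. \<exists>c\<in>insert p C. g c dvd x} =
         card {x \<in> {1..n}. \<exists>c\<in>C. g c dvd x} +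
         card {k \<in> {1..n div g p}. \<not> (\<exists>c\<in>C. g c dvd k)}"
proof -
  let ?A = "{x \<in> {1..n}. \<exists>c\<in>C. g c dvd x}"
  let ?B = "{k \<in> {1..n div g p}. \<not> (\<exists>c\<in>C. g c dvd k)}"
  have dvd_iff: "g c dvd g p * k \<longleftrightarrow> g c dvd k" if "c \<in> C" for c k
    using assms(2)[OF that] by (rule coprime_dvd_mult_right_iff)
  have bound: "k \<le> n div g p \<longleftrightarrow> g p * k \<le> n" for k
    using assms(1) by (simp add: less_eq_div_iff_mult_less_eq mult.commute)
  have eq: "{x \<in> {1..n}. \<exists>c\<in>insert p C. g c dvd x} = ?A \<union> (\<lambda>k. g p * k) ` ?B"
  proof (intro equalityI subsetI)
    fix x assume "x \<in> {x \<in> {1..n}. \<exists>c\<in>insert p C. g c dvd x}"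
    then have x: "x \<in> {1..n}" "g p dvd x \<or> (\<exists>c\<in>C. g c dvd x)"
      by auto
    show "x \<in> ?A \<union> (\<lambda>k. g p * k) ` ?B"
    proof (cases "\<exists>c\<in>C. g c dvd x")
      case False
      then obtain k where "x = g p * k"
        using x by (auto elim: dvdE)
      then show ?thesis
        using x False assms(1) by (auto simp: bound dvd_iff intro!: imageI)
    qed (use x in auto)
  next
    fix x assume "x \<in> ?A \<union> (\<lambda>k. g p * k) ` ?B"
    then show "x \<in> {x \<in> {1..n}. \<exists>c\<in>insert p C. g c dvd x}"
      using assms(1) by (auto simp: bound)
  qed
  have disj: "?A \<inter> (\<lambda>k. g p * k) ` ?B = {}"
    by (auto simp: dvd_iff)
  have "inj_on (\<lambda>k. g p * k) ?B"
    using assms(1) by (auto simp: inj_on_def)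
  then show ?thesis
    unfolding eq by (subst card_Un_disjoint) (use disj in \<open>auto simp: card_image\<close>)
qed

lemma card_multiples_eq:
  fixes g :: "'b \<Rightarrow> nat" and P Q :: "'b set"
  assumes "finite P" "finite Q" "card P = card Q"
    and pos: "\<And>p. p \<in> P \<union> Q \<Longrightarrow> g p > 0"
    and coprime: "\<And>p q. p \<in> P \<union> Q \<Longrightarrow> q \<in> P \<union> Q \<Longrightarrow> p \<noteq> q \<Longrightarrow> coprime (g p) (g q)"
    and inj: "inj_on g (P \<union> Q)"
    and P: "\<And>p p'. p \<in> P \<Longrightarrow> p' \<in> P \<Longrightarrow> p \<noteq> p' \<Longrightarrow> g p * g p' \<le> n"
    and Q: "\<And>q q'. q \<in> Q \<Longrightarrow> q' \<in> Q \<Longrightarrow> q \<noteq> q' \<Longrightarrow> g q * g q' \<le> n"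
    and match: "\<And>p. p \<in> P \<Longrightarrow> \<exists>q\<in>Q. n div g p = n div g q"
  shows "card {x \<in> {1..n}. \<exists>p\<in>P. g p dvd x} = card {x \<in> {1..n}. \<exists>q\<in>Q. g q dvd x}"
proof -
  have eqI: "p = q" if "p \<in> P \<union> Q" "q \<in> P \<union> Q" "g p * g q \<le> n" "n div g p = n div g q" for p q
    using div_eq_imp_eq[OF pos pos] that inj by (auto dest: inj_onD)
  obtain s where s: "\<And>p. p \<in> P \<Longrightarrow> s p \<in> Q" "\<And>p. p \<in> P \<Longrightarrow> n div g p = n div g (s p)"
    using match by metis
  have unique: "p = p'" if "p \<in> P - Q" "p' \<in> P - Q" for p p'
  proof (rule ccontr)
    assume "p \<noteq> p'"
    have "s p \<noteq> s p'"
      using that \<open>p \<noteq> p'\<close> s(2)[of p] s(2)[of p'] eqI[of p p'] P[of p p'] by auto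
    then have "(g p * g p') * (g (s p) * g (s p')) \<le> n * n"
      using that s(1)[of p] s(1)[of p'] P[of p p'] Q[of "s p" "s p'"] \<open>p \<noteq> p'\<close>
      by (intro mult_le_mono) auto
    \<comment> \<open>Otherwise \<open>eqI\<close> would give \<open>r = s r\<close>, which lies in
      \<open>Q\<close>. The product of the four values is then above \<open>n * n\<close> when
      grouped by matched pairs, but at most \<open>n * n\<close> when grouped within
      \<open>P\<close> and within \<open>Q\<close>.\<close>
    moreover have less: "n < g r * g (s r)" if "r \<in> P - Q" for r
      using that s[of r] eqI[of r "s r"] by (metis DiffD1 DiffD2 UnCI leI)
    then have "n * n < (g p * g (s p)) * (g p' * g (s p'))"
      using that pos s(1) by (intro mult_strict_mono) auto
    ultimately show False
      by (simp add: mult_ac)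
  qed
  show ?thesis
  proof (cases "P \<subseteq> Q")
    case True
    then show ?thesis
      using assms by (metis card_subset_eq)
  next
    case False
    then obtain p where p: "p \<in> P" "p \<notin> Q"
      by auto
    define C where "C = P \<inter> Q"
    have P_eq: "P = insert p C"
      using p unique by (auto simp: C_def)
    have "p \<noteq> s p"
      using p s(1) by metis
    \<comment> \<open>Two distinct members of \<open>P\<close> have product at most
      \<open>n\<close>, so they cannot share a quotient.\<close>
    then have "s p \<notin> P"
      using p s[of p] eqI[of p "s p"] P[of p "s p"] by auto
    then have sp: "s p \<notin> C" "s p \<in> Q"
      using s(1)[OF p(1)] by (auto simp: C_def)
    have "finite C" "p \<notin> C"
      using assms(1) p by (auto simp: C_def)
    \<comment> \<open>\<open>Q\<close> contains \<open>insert (s p) C\<close>; equal size leaves no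
      room for anything else.\<close>
    then have "card Q = card (insert (s p) C)"
      using sp P_eq assms(3) by simp
    then have Q_eq: "Q = insert (s p) C"
      using sp assms(2) by (intro card_subset_eq[symmetric]) (auto simp: C_def)
    have *: "coprime (g c) (g q)" if "c \<in> C" "q = p \<or> q = s p" for c q
      using that p sp \<open>p \<notin> C\<close> by (intro coprime) (auto simp: C_def)
    have "card {x \<in> {1..n}. \<exists>c\<in>insert p C. g c dvd x} =
          card {x \<in> {1..n}. \<exists>c\<in>insert (s p) C. g c dvd x}"
      using card_multiples_insert[of g p C n] card_multiples_insert[of g "s p" C n]
        * s(2)[OF p(1)] pos[of p] pos[of "s p"] p sp by simp
    then show ?thesis
      by (simp only: P_eq[symmetric] Q_eq[symmetric])
  qed
qed

section \<open>Reduced labels and degrees\<close>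

text \<open>The multiplicity of \<open>p\<close> in \<open>gcd x n\<close> is the smaller of those
  in \<open>x\<close> and \<open>n\<close>, so a factor \<open>p\<close> survives the division
  exactly when \<open>x\<close> has more factors \<open>p\<close> than \<open>n\<close>.\<close>

lemma prime_dvd_div_gcd_iff:
  fixes p x n :: nat
  assumes "prime p" "x > 0" "n > 0"
  shows "p dvd x div gcd x n \<longleftrightarrow> p ^ succ_valuation p n dvd x"
proof -
  let ?g = "gcd x n"
  have "\<not> is_unit p"
    using assms(1) by auto
  have nz: "x div ?g \<noteq> 0" "?g \<noteq> 0"
    using assms by (auto simp: dvd_div_eq_0_iff)
  have "multiplicity p x = multiplicity p (x div ?g * ?g)"
    by simp
  also have "\<dots> = multiplicity p (x div ?g) + multiplicity p ?g"
    using assms(1) nz by (intro prime_elem_multiplicity_mult_distrib) auto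
  finally have sum: "multiplicity p x = multiplicity p (x div ?g) + multiplicity p ?g" .
  have dvd: "p dvd x div ?g \<longleftrightarrow> 0 < multiplicity p (x div ?g)"
    using nz \<open>\<not> is_unit p\<close> by (simp add: multiplicity_gt_zero_iff)
  have pow: "p ^ k dvd y \<longleftrightarrow> k \<le> multiplicity p y" if "y > 0" for k y
    using that \<open>\<not> is_unit p\<close> by (intro power_dvd_iff_le_multiplicity) auto
  have "multiplicity p ?g \<le> multiplicity p n"
    using assms by (intro dvd_imp_multiplicity_le) auto
  moreover have "multiplicity p x \<le> multiplicity p ?g" if "multiplicity p x \<le> multiplicity p n"
  proof -
    have "p ^ multiplicity p x dvd ?g"
      using that assms by (simp add: pow multiplicity_dvd)
    then show ?thesis
      using nz(2) by (intro pow[THEN iffD1]) auto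
  qed
  ultimately show ?thesis
    unfolding dvd pow[OF assms(2)] succ_valuation_def using sum by fastforce
qed

text \<open>The gcd fails to divide \<open>n\<close> exactly when, for some prime \<open>p\<close>,
  the least power of \<open>p\<close> not dividing \<open>n\<close> divides both arguments. For
  \<open>x\<close> this says that \<open>p\<close> divides the reduced value.\<close>

lemma gcd_dvd_iff:
  fixes x y n :: nat
  assumes "x > 0" "n > 0"
  shows "gcd x y dvd n \<longleftrightarrow> \<not> (\<exists>p\<in>prime_factors (x div gcd x n). p ^ succ_valuation p n dvd y)"
proof -
  have "x div gcd x n \<noteq> 0"
    using assms by (auto simp: dvd_div_eq_0_iff)
  then have pf: "p \<in> prime_factors (x div gcd x n) \<longleftrightarrow> prime p \<and> p ^ succ_valuation p n dvd x" for p
    using prime_dvd_div_gcd_iff[of p x n] assms by (auto simp: prime_factors_dvd)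
  have not_dvd: "\<not> p ^ succ_valuation p n dvd n" if "prime p" for p
  proof -
    have "\<not> is_unit p" using that by auto
    then show ?thesis
      using assms(2) power_dvd_iff_le_multiplicity[of n p "succ_valuation p n"]
      by (simp add: succ_valuation_def del: power_Suc)
  qed
  show ?thesis
  proof
    assume gcd: "gcd x y dvd n"
    show "\<not> (\<exists>p\<in>prime_factors (x div gcd x n). p ^ succ_valuation p n dvd y)"
    proof
      assume "\<exists>p\<in>prime_factors (x div gcd x n). p ^ succ_valuation p n dvd y"
      then obtain p where p: "prime p" "p ^ succ_valuation p n dvd x" "p ^ succ_valuation p n dvd y"
        using pf by auto
      show False
        using not_dvd[OF p(1)] dvd_trans[OF gcd_greatest[OF p(2,3)] gcd] by contradiction
    qed
  next
    assume no: "\<not> (\<exists>p\<in>prime_factors (x div gcd x n). p ^ succ_valuation p n dvd y)"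
    have nz: "gcd x y \<noteq> 0"
      using assms by simp
    show "gcd x y dvd n"
    proof (rule multiplicity_le_imp_dvd[OF nz])
      fix p :: nat assume p: "prime p"
      show "multiplicity p (gcd x y) \<le> multiplicity p n"
      proof (rule ccontr)
        assume "\<not> ?thesis"
        then have "p ^ succ_valuation p n dvd gcd x y"
          by (intro multiplicity_dvd') (simp add: succ_valuation_def)
        then have "p ^ succ_valuation p n dvd x" "p ^ succ_valuation p n dvd y"
          by auto
        then show False
          using no p pf by blast
      qed
    qed
  qed
qed

text \<open>Maximality excludes every labelling of the enlarged graph. If the gcd condition holds
  for a missing edge, \<open>f\<close> itself still labels the enlarged graph, a
  contradiction.\<close>

lemma arc_maximal_diophantine_iff:
  assumes max: "maximal_diophantine_graph D" and lab: "diophantine_labelling D f"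
    and "u \<in> pverts D" "v \<in> pverts D"
  shows "(u, v) \<in> parcs D \<longleftrightarrow> u \<noteq> v \<and> gcd (f u) (f v) dvd card (pverts D)"
proof -
  interpret pair_graph D
    using max by (simp add: maximal_diophantine_graph_def diophantine_graph_def)
  show ?thesis
  proof
    assume "(u, v) \<in> parcs D"
    then show "u \<noteq> v \<and> gcd (f u) (f v) dvd card (pverts D)"
      using lab pair_no_loops[of "(u, v)"] by (auto simp: diophantine_labelling_def)
  next
    assume uv: "u \<noteq> v \<and> gcd (f u) (f v) dvd card (pverts D)"
    show "(u, v) \<in> parcs D"
    proof (rule ccontr)
      assume "(u, v) \<notin> parcs D"
      then have "\<not> diophantine_graph (add_edge D u v)"
        using max uv assms(3,4) by (auto simp: maximal_diophantine_graph_def)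
      moreover have "pair_graph (add_edge D u v)"
      proof unfold_locales
        show "symmetric (with_proj (add_edge D u v))"
          using pair_sym_arcs by (auto simp: symmetric_def sym_def add_edge_def)
      qed (use uv assms(3,4) pair_finite_verts pair_finite_arcs pair_no_loops
          in \<open>auto simp: add_edge_def dest: in_arcsD1 in_arcsD2\<close>)
      moreover have "diophantine_labelling (add_edge D u v) f"
        using lab uv by (auto simp: diophantine_labelling_def add_edge_def gcd.commute)
      ultimately show False
        by (auto simp: diophantine_graph_def)
    qed
  qed
qed

lemma vertex_degree_eq_card:
  assumes "pair_graph D"
  shows "vertex_degree D u = card {w \<in> pverts D. (u, w) \<in> parcs D}"
proof -
  interpret pair_graph D by fact
  have "out_arcs (with_proj D) u = Pair u ` {w \<in> pverts D. (u, w) \<in> parcs D}"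
    by (auto simp: out_arcs_def dest: in_arcsD2)
  then show ?thesis
    by (simp add: vertex_degree_def out_degree_def card_image inj_on_def)
qed

lemma vertex_degree_maximal_diophantine:
  assumes max: "maximal_diophantine_graph D" and lab: "diophantine_labelling D f"
    and n: "card (pverts D) = n" "n > 0" and u: "u \<in> pverts D"
    and deg: "vertex_degree D u < n - 1"
  shows "vertex_degree D u = n - card {x \<in> {1..n}.
           \<exists>p\<in>prime_factors (reduced_label n f u). p ^ succ_valuation p n dvd x}"
proof -
  let ?bad = "\<lambda>x. \<exists>p\<in>prime_factors (reduced_label n f u). p ^ succ_valuation p n dvd x"
  have bij: "bij_betw f (pverts D) {1..n}"
    using lab n by (simp add: diophantine_labelling_def)
  then have "f u > 0"
    using u by (force simp: bij_betw_def)
  then have gcd_iff: "gcd (f u) x dvd n \<longleftrightarrow> \<not> ?bad x" for x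
    using n by (simp add: gcd_dvd_iff reduced_label_def)
  have fin: "finite (pverts D)"
    using n card_ge_0_finite by auto
  have "pair_graph D"
    using max by (simp add: maximal_diophantine_graph_def diophantine_graph_def)
  then have deg_eq: "vertex_degree D u = card {w \<in> pverts D. u \<noteq> w \<and> \<not> ?bad (f w)}"
    unfolding vertex_degree_eq_card[OF \<open>pair_graph D\<close>]
    using arc_maximal_diophantine_iff[OF max lab u] n gcd_iff
    by (intro arg_cong[where f = card]) auto
  \<comment> \<open>This is where the degree bound enters: otherwise \<open>f u\<close> divides
    \<open>n\<close>, no label is bad, and \<open>u\<close> is adjacent to all other vertices. Since
    \<open>f u\<close> is itself bad, the condition \<open>u \<noteq> w\<close> becomes automatic
    and the count needs no correction by one.\<close>
  have "?bad (f u)"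
  proof (rule ccontr)
    assume "\<not> ?bad (f u)"
    then have "f u dvd n"
      using gcd_iff[of "f u"] by simp
    then have "\<not> ?bad x" for x
      using gcd_iff[of x] by (meson dvd_trans gcd_dvd1)
    then have "{w \<in> pverts D. u \<noteq> w \<and> \<not> ?bad (f w)} = pverts D - {u}"
      by auto
    then show False
      using deg deg_eq u n fin by (simp add: card_Diff_singleton)
  qed
  then have "{w \<in> pverts D. u \<noteq> w \<and> \<not> ?bad (f w)} = {w \<in> pverts D. \<not> ?bad (f w)}"
    by auto
  moreover have "card {w \<in> pverts D. \<not> ?bad (f w)} = card (f ` {w \<in> pverts D. \<not> ?bad (f w)})"
    using bij by (intro card_image[symmetric]) (auto simp: bij_betw_def intro: inj_on_subset)
  moreover have "f ` {w \<in> pverts D. \<not> ?bad (f w)} = {1..n} - {x \<in> {1..n}. ?bad x}"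
    using bij by (fastforce simp: bij_betw_def)
  moreover have "card ({1..n} - {x \<in> {1..n}. ?bad x}) = n - card {x \<in> {1..n}. ?bad x}"
    by (subst card_Diff_subset) auto
  ultimately show ?thesis
    using deg_eq by simp
qed

theorem theorem4p6:
  fixes D :: "'a pair_pre_digraph" and f :: "'a \<Rightarrow> nat" and n :: nat and u v :: 'a
  assumes "n > 0"
    and "maximal_diophantine_graph D"
    and "card (pverts D) = n"
    and "diophantine_labelling D f"
    and "u \<in> pverts D" and "v \<in> pverts D"
    and "vertex_degree D u < n - 1" and "vertex_degree D v < n - 1"
    and "omega (reduced_label n f u) = omega (reduced_label n f v)"
    and "\<forall>p. prime p \<and> p dvd reduced_label n f u \<longrightarrow>
           (\<exists>q. prime q \<and> q dvd reduced_label n f v \<and>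
              \<lfloor>real n / real (p ^ succ_valuation p n)\<rfloor> = \<lfloor>real n / real (q ^ succ_valuation q n)\<rfloor>)"
  shows "vertex_degree D u = vertex_degree D v"
proof -
  let ?g = "\<lambda>p. p ^ succ_valuation p n"
  let ?P = "\<lambda>w. prime_factors (reduced_label n f w)"
  have label: "0 < f w \<and> f w \<le> n" if "w \<in> pverts D" for w
    using assms(3,4) that by (force simp: diophantine_labelling_def bij_betw_def)
  have pf: "p \<in> ?P w \<longleftrightarrow> prime p \<and> p dvd reduced_label n f w" if "w \<in> pverts D" for p w
    using label[OF that] by (auto simp: prime_factors_dvd reduced_label_def dvd_div_eq_0_iff)
  have coprime: "coprime (?g p) (?g q)" if "prime p" "prime q" "p \<noteq> q" for p q
    using that by (auto intro: primes_coprime)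
  have prod_le: "?g p * ?g q \<le> n" if "w \<in> pverts D" "p \<in> ?P w" "q \<in> ?P w" "p \<noteq> q" for w p q
  proof -
    have "?g p dvd f w" "?g q dvd f w"
      using that label[of w] assms(1) pf prime_dvd_div_gcd_iff[of _ "f w" n]
      by (auto simp: reduced_label_def)
    then have "?g p * ?g q dvd f w"
      using coprime[of p q] that pf by (intro divides_mult) auto
    then show ?thesis
      using label[OF that(1)] by (auto dest: dvd_imp_le)
  qed
  have "card {x \<in> {1..n}. \<exists>p\<in>?P u. ?g p dvd x} = card {x \<in> {1..n}. \<exists>q\<in>?P v. ?g q dvd x}"
  proof (rule card_multiples_eq)
    show "card (?P u) = card (?P v)"
      using assms(9) by (simp add: omega_def)
    show "inj_on ?g (?P u \<union> ?P v)"
    proof (rule inj_onI)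
      fix p q assume "p \<in> ?P u \<union> ?P v" "q \<in> ?P u \<union> ?P v" and eq: "?g p = ?g q"
      then have "prime p" "prime q"
        by auto
      \<comment> \<open>The successor in \<open>succ_valuation\<close> keeps both exponents
        positive, even for primes not dividing \<open>n\<close>, so the power determines its
        prime.\<close>
      then show "p = q"
        by (rule prime_power_inj'(1)[OF _ _ eq]) (auto simp: succ_valuation_def)
    qed
    show "\<exists>q\<in>?P v. n div ?g p = n div ?g q" if "p \<in> ?P u" for p
    proof -
      obtain q where "prime q" "q dvd reduced_label n f v"
        and "\<lfloor>real n / real (?g p)\<rfloor> = \<lfloor>real n / real (?g q)\<rfloor>"
        using assms(10) pf[OF assms(5)] \<open>p \<in> ?P u\<close> by blast
      \<comment> \<open>The floor of the real quotient of two naturals is their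
        \<open>div\<close>.\<close>
      then show ?thesis
        using pf[OF assms(6)] unfolding floor_divide_of_nat_eq by auto
    qed
    show "?g p > 0" if "p \<in> ?P u \<union> ?P v" for p
      using that by (auto intro!: prime_gt_0_nat)
    show "coprime (?g p) (?g q)" if "p \<in> ?P u \<union> ?P v" "q \<in> ?P u \<union> ?P v" "p \<noteq> q" for p q
      using that by (intro coprime) auto
  qed (use prod_le assms(5,6) in auto)
  then show ?thesis
    unfolding vertex_degree_maximal_diophantine[OF assms(2,4,3,1,5,7)]
      vertex_degree_maximal_diophantine[OF assms(2,4,3,1,6,8)] by (rule arg_cong)
qed

end
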